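(* Let $H$ be a sparse semigroup of genus $g$ with even Frobenius number $\ell_g=2g-2r$, where $r$ is a positive integer. Then $g\le 4r-1$.
   Context: $\mathbb{N}$ is the set of natural numbers including $0$. A numerical semigroup $H\subseteq\mathbb{N}$ of genus $g\ge 1$ is a subset containing $0$, closed under addition, whose complement $\mathbb{N}\setminus H=\{1=\ell_1<\ell_2<\dots<\ell_g\}$ has exactly $g$ elements, called gaps; $\ell_g$ is the Frobenius number. $H$ is sparse if $\ell_i-\ell_{i-1}\le 2$ for all $i=2,\dots,g$. *)

theory Defs
  imports Main
begin

definition numerical_semigroup :: "nat set \<Rightarrow> bool" where
  "numerical_semigroup H \<longleftrightarrow>
     0 \<in> H \<and> (\<forall>x\<in>H. \<forall>y\<in>H. x + y \<in> H) \<and> finite (- H)"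

definition gaps :: "nat set \<Rightarrow> nat set" where
  "gaps H = - H"

definition genus :: "nat set \<Rightarrow> nat" where
  "genus H = card (gaps H)"

text \<open>
  The gaps are enumerated increasingly from index 1, so \<open>gap H i\<close> is
  $\ell_i$; it is meaningful only for \<open>1 \<le> i \<le> genus H\<close>.
\<close>

definition gap :: "nat set \<Rightarrow> nat \<Rightarrow> nat" where
  "gap H i = sorted_list_of_set (gaps H) ! (i - 1)"

text \<open>Meaningful only for positive genus, as for \<open>gap\<close>.\<close>

definition frobenius :: "nat set \<Rightarrow> nat" where
  "frobenius H = gap H (genus H)"

definition sparse :: "nat set \<Rightarrow> bool" where
  "sparse H \<longleftrightarrow>
     (\<forall>i\<in>{2..genus H}. int (gap H i) - int (gap H (i - 1)) \<le> 2)"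

lemma gap_strict_mono:
  assumes "1 \<le> i" "i < j" "j \<le> genus H"
  shows "gap H i < gap H j"
  using assms sorted_wrt_nth_less[OF strict_sorted_list_of_set, of "i - 1" "j - 1" "gaps H"]
  by (simp add: gap_def genus_def)

lemma gap_image:
  assumes "numerical_semigroup H"
  shows "gap H ` {1..genus H} = gaps H"
proof -
  have "(\<lambda>i. i - 1) ` {1..genus H} = {..<genus H}"
    by (auto simp: image_iff intro!: bexI[where x = "Suc _"])
  then have "gap H ` {1..genus H} = (!) (sorted_list_of_set (gaps H)) ` {..<genus H}"
    unfolding gap_def by (metis image_image)
  also have "\<dots> = set (sorted_list_of_set (gaps H))"
    by (auto simp: set_conv_nth genus_def)
  finally show ?thesis
    using assms by (simp add: numerical_semigroup_def gaps_def)
qed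

lemma frobenius_eq_Max:
  assumes "numerical_semigroup H" "genus H \<ge> 1"
  shows "frobenius H = Max (gaps H)"
proof (rule Max_eqI [symmetric])
  show "finite (gaps H)"
    using assms by (simp add: numerical_semigroup_def gaps_def)
  show "frobenius H \<in> gaps H"
    using assms gap_image[of H] by (auto simp: frobenius_def)
  fix y assume "y \<in> gaps H"
  then obtain i where "1 \<le> i" "i \<le> genus H" "y = gap H i"
    using gap_image[OF assms(1)] by (metis atLeastAtMost_iff imageE)
  then show "y \<le> frobenius H"
    using gap_strict_mono[of i "genus H" H] by (cases "i = genus H") (auto simp: frobenius_def)
qed

end

theory Submission
  imports Defs
begin

text \<open>
  Let \<open>D\<close> be the number of nonzero elements of \<open>H\<close> below \<open>F = \<ell>\<^sub>g\<close> and \<open>S\<close> the number of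
  pairs of consecutive gaps. Sparseness means that the elements of \<open>H\<close> below \<open>F\<close> are isolated, so
  \<open>D = g - 2r\<close> and \<open>S = 2r - 1\<close>, and the claim is \<open>D \<le> S\<close>.

  Let \<open>k\<close> be maximal such that \<open>F - 1, F - 3, \<dots>, F - (2k - 1)\<close> lie in \<open>H\<close>, and put
  \<open>c = F - 2k - 1\<close>. Then \<open>c\<close> and \<open>c + 1\<close> are gaps, hence so are \<open>c - h\<close> and \<open>c + 1 - h\<close> for every
  \<open>h \<in> H\<close> below \<open>c\<close>; this yields \<open>D - k + 1\<close> pairs. The evenness of \<open>F\<close> forces \<open>1, \<dots>, 2k - 1\<close> to
  be gaps, and for each \<open>j = 1, \<dots>, k - 1\<close> one of the pairs starting at \<open>2j - 1\<close> and \<open>2j\<close> is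
  new, because \<open>c - 2j + 1\<close> and \<open>c - 2j\<close> are not both in \<open>H\<close>.
\<close>

lemma numerical_semigroup_mult_closed:
  assumes "numerical_semigroup H" "n \<in> H"
  shows "n * q \<in> H"
  using assms by (induction q) (auto simp: numerical_semigroup_def)

text \<open>If \<open>x\<close> were below the last gap, the first gap beyond \<open>x\<close> and
  its predecessor would straddle both \<open>x\<close> and \<open>Suc x\<close>, hence differ by at
  least 3. The predecessor exists because 1 is a gap and \<open>x \<ge> 1\<close>.\<close>

lemma sparse_isolated:
  assumes H: "numerical_semigroup H" and g: "genus H \<ge> 1" and sp: "sparse H"
    and x: "x \<in> H" "Suc x \<in> H"
  shows "frobenius H \<le> x"
proof (rule ccontr)
  assume "\<not> frobenius H \<le> x"
  then have lt: "x < gap H (genus H)" by (simp add: frobenius_def)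
  have one: "1 \<notin> H"
  proof
    assume "1 \<in> H"
    then have "gaps H = {}"
      using numerical_semigroup_mult_closed[OF H, of 1] by (auto simp: gaps_def)
    with g show False by (simp add: genus_def)
  qed
  with x have "x \<ge> 1" by (cases x) auto
  define i where "i = (LEAST i. 1 \<le> i \<and> x < gap H i)"
  have i: "1 \<le> i" "x < gap H i"
    unfolding i_def using LeastI[of "\<lambda>i. 1 \<le> i \<and> x < gap H i" "genus H"] lt g by auto
  have ile: "i \<le> genus H"
    unfolding i_def by (rule Least_le) (use lt g in auto)
  have gap_notin: "gap H l \<notin> H" if "1 \<le> l" "l \<le> genus H" for l
    using gap_image[OF H] that by (auto simp: gaps_def)
  obtain l where l: "1 \<le> l" "l \<le> genus H" "gap H l = 1"
    using gap_image[OF H] one by (metis ComplI atLeastAtMost_iff gaps_def imageE)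
  have "gap H 1 \<le> 1"
    using gap_strict_mono[of 1 l H] l by (cases "l = 1") auto
  with i \<open>x \<ge> 1\<close> have "i \<noteq> 1" by auto
  with i have i2: "i \<ge> 2" by auto
  have "\<not> x < gap H (i - 1)"
    using not_less_Least[of "i - 1" "\<lambda>i. 1 \<le> i \<and> x < gap H i"] i2 unfolding i_def[symmetric] by auto
  moreover have "gap H (i - 1) \<noteq> x" "gap H i \<noteq> Suc x"
    using gap_notin[of "i - 1"] gap_notin[of i] x i2 ile by fastforce+
  ultimately have "int (gap H i) - int (gap H (i - 1)) > 2"
    using i by linarith
  then show False
    using sp i2 ile by (force simp: sparse_def)
qed

text \<open>Elements of \<open>H\<close>, their predecessors and the starts of gap pairs partition
  \<open>{1..<F}\<close>. The first two classes are disjoint by isolation and equinumerous because 1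
  and \<open>F\<close> are gaps.\<close>

lemma card_below_isolated:
  fixes H :: "nat set"
  assumes one: "1 \<notin> H" and F: "F \<notin> H" and iso: "\<And>x. x \<in> H \<Longrightarrow> Suc x \<in> H \<Longrightarrow> F \<le> x"
  shows "2 * card (H \<inter> {1..<F}) + card {x \<in> {1..<F}. x \<notin> H \<and> Suc x \<notin> H} = F - 1"
proof -
  let ?D = "H \<inter> {1..<F}" and ?S = "{x \<in> {1..<F}. x \<notin> H \<and> Suc x \<notin> H}"
  let ?E = "{x \<in> {1..<F}. Suc x \<in> H}"
  have "Suc ` ?E = ?D"
  proof (intro equalityI subsetI)
    fix y assume y: "y \<in> ?D"
    with one have "y \<noteq> 1" by auto
    with y have "y = Suc (y - 1)" "y - 1 \<in> ?E" by auto
    then show "y \<in> Suc ` ?E" by blast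
  next
    fix y assume "y \<in> Suc ` ?E"
    then obtain x where x: "y = Suc x" "1 \<le> x" "x < F" "Suc x \<in> H" by auto
    with F have "Suc x \<noteq> F" by auto
    with x show "y \<in> ?D" by auto
  qed
  then have E: "card ?E = card ?D" by (metis card_image inj_Suc inj_on_subset subset_UNIV)
  have "{1..<F} = (?D \<union> ?E) \<union> ?S" by auto
  then have "F - 1 = card ((?D \<union> ?E) \<union> ?S)" by (metis card_atLeastLessThan)
  also have "\<dots> = card (?D \<union> ?E) + card ?S" by (rule card_Un_disjoint) auto
  also have "card (?D \<union> ?E) = card ?D + card ?E"
    by (rule card_Un_disjoint) (use iso in fastforce)+
  finally show ?thesis using E by simp
qed

lemma card_nongaps_le_card_gap_pairs:
  assumes H: "numerical_semigroup H" and F: "F \<notin> H" "even F"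
    and iso: "\<And>x. x \<in> H \<Longrightarrow> Suc x \<in> H \<Longrightarrow> F \<le> x"
  shows "card (H \<inter> {1..<F}) \<le> card {x \<in> {1..<F}. x \<notin> H \<and> Suc x \<notin> H}"
    (is "card ?D \<le> card ?S")
proof -
  have H0: "0 \<in> H" and add: "\<And>x y. x \<in> H \<Longrightarrow> y \<in> H \<Longrightarrow> x + y \<in> H"
    using H by (auto simp: numerical_semigroup_def)
  have "F \<noteq> 0" using F H0 by metis
  with F have F2: "F \<ge> 2" by (cases F) (auto elim: oddE)
  then have one: "1 \<notin> H" using iso[of 0] H0 by auto
  define k where "k = (LEAST k. F - 2 * k - 1 \<notin> H)"
  \<comment> \<open>As \<open>F\<close> is even, descending by twos from \<open>F - 1\<close> ends
    at the gap 1.\<close>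
  have ex: "F - 2 * ((F - 2) div 2) - 1 \<notin> H"
  proof -
    have "F - 2 * ((F - 2) div 2) - 1 = 1" using F F2 by (auto elim!: evenE)
    then show ?thesis using one by simp
  qed
  have kle: "k \<le> (F - 2) div 2" unfolding k_def using ex by (rule Least_le)
  then have k2: "2 * k + 2 \<le> F" using F2 by linarith
  define c where "c = F - 2 * k - 1"
  have c: "c \<notin> H" unfolding c_def k_def using ex by (rule LeastI)
  have Fc: "F = c + 2 * k + 1" "c \<ge> 1" using k2 by (auto simp: c_def)
  have odds: "F - 2 * j - 1 \<in> H" if "j < k" for j
    using not_less_Least that unfolding k_def by blast
  have evens: "F - 2 * j \<notin> H" if "j \<le> k" for j
  proof (cases j)
    case 0 then show ?thesis using F by simp
  next
    case (Suc i)
    have "F - 2 * i - 1 = Suc (F - 2 * j)" using Suc that k2 by auto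
    then have "Suc (F - 2 * j) \<in> H" using odds[of i] Suc that by auto
    then show ?thesis using iso[of "F - 2 * j"] Suc F2 by force
  qed
  have evens': "y \<notin> H" if y: "even y" "c < y" "y \<le> F" for y
  proof -
    obtain j where "F - y = 2 * j" using y F by (metis dvd_diff_nat evenE)
    then have "y = F - 2 * j" "j \<le> k" using y Fc by linarith+
    then show ?thesis using evens by blast
  qed
  have low: "2 * k \<le> n" if n: "n \<in> H" "n > 0" for n
  proof (rule ccontr)
    assume less: "\<not> 2 * k \<le> n"
    show False
    proof (cases "even n")
      case True
      \<comment> \<open>The largest multiple of \<open>n\<close> up to \<open>F\<close> is even and,
        since \<open>n < 2 * k\<close>, exceeds \<open>c\<close>.\<close>
      have "n * (F div n) + F mod n = F" "F mod n < n" using n by auto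
      then have "c < n * (F div n)" "n * (F div n) \<le> F" using less Fc by linarith+
      then show False
        using evens'[of "n * (F div n)"] True numerical_semigroup_mult_closed[OF H n(1)] by auto
    next
      case False
      \<comment> \<open>Adding the odd \<open>n\<close> to the odd element \<open>c + 2\<close>
        gives an even element in the range \<open>c < y \<le> F\<close>.\<close>
      have "F - 2 * (k - 1) - 1 \<in> H" using odds[of "k - 1"] less by auto
      moreover have "F - 2 * (k - 1) - 1 = c + 2" using less Fc by auto
      ultimately have "c + 2 + n \<in> H" using add n by metis
      moreover have "even (c + 2 + n)" using False F Fc by auto
      ultimately show False using evens'[of "c + 2 + n"] less False Fc by presburger
    qed
  qed
  have c1: "Suc c \<notin> H" using evens[of k] Fc by auto
  define A where "A = (\<lambda>h. c - h) ` (H \<inter> {..<c})"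
  have AS: "A \<subseteq> ?S"
  proof
    fix x assume "x \<in> A"
    then obtain h where h: "h \<in> H" "h < c" "x = c - h" by (auto simp: A_def)
    then have "x + h = c" "Suc x + h = Suc c" by auto
    then have "x \<notin> H" "Suc x \<notin> H" using add h c c1 by metis+
    then show "x \<in> ?S" using h Fc by auto
  qed
  have cardA: "card A = card (H \<inter> {..<c})"
    unfolding A_def by (rule card_image) (auto simp: inj_on_def)
  \<comment> \<open>Chosen to avoid \<open>A\<close>: if \<open>c - (2 * j + 1)\<close> is in
    \<open>H\<close>, isolation excludes its predecessor. If the subtraction truncates to
    \<open>0 \<in> H\<close>, then \<open>2 * j + 2\<close> exceeds \<open>c\<close>, beyond all of
    \<open>A\<close>.\<close>
  define f where "f j = (if c - (2 * j + 1) \<in> H then 2 * j + 2 else 2 * j + 1)" for j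
  define C where "C = f ` {..<k - 1}"
  have CS: "C \<subseteq> ?S"
  proof
    fix x assume "x \<in> C"
    then obtain j where "j < k - 1" "x = f j" by (auto simp: C_def)
    then have x: "x \<ge> 1" "Suc x < 2 * k" by (auto simp: f_def)
    then have "x \<notin> H" "Suc x \<notin> H" using low[of x] low[of "Suc x"] by auto
    then show "x \<in> ?S" using x Fc by auto
  qed
  have "i = j" if "f i = f j" for i j
  proof -
    have "(f l - 1) div 2 = l" for l by (simp add: f_def)
    then show ?thesis using that by metis
  qed
  then have "inj_on f {..<k - 1}" by (rule inj_onI)
  then have cardC: "card C = k - 1" by (simp add: C_def card_image)
  have AC: "A \<inter> C = {}"
  proof (rule ccontr)
    assume "A \<inter> C \<noteq> {}"
    then obtain h j where h: "h \<in> H" "h < c" and eq: "c - h = f j"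
      by (auto simp: A_def C_def)
    show False
    proof (cases "c - (2 * j + 1) \<in> H")
      case True
      then have "c - h = 2 * j + 2" using eq by (simp add: f_def)
      then have "Suc h = c - (2 * j + 1)" by auto
      then show False using True iso[of h] h Fc by auto
    next
      case False
      then have "c - h = 2 * j + 1" using eq by (simp add: f_def)
      then have "h = c - (2 * j + 1)" using h by auto
      then show False using False h by auto
    qed
  qed
  \<comment> \<open>Inserting 0, which \<open>A\<close> counts through \<open>h = 0\<close>, gains
    the 1 that offsets \<open>card C = k - 1\<close>.\<close>
  have "insert 0 ?D \<subseteq> (H \<inter> {..<c}) \<union> (\<lambda>j. F - 2 * j - 1) ` {..<k}"
  proof
    fix y assume y: "y \<in> insert 0 ?D"
    show "y \<in> (H \<inter> {..<c}) \<union> (\<lambda>j. F - 2 * j - 1) ` {..<k}"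
    proof (cases "y < c")
      case True then show ?thesis using y H0 by auto
    next
      case False
      with y Fc c have y': "y \<in> H" "c < y" "y < F" by (auto simp: nat_less_le)
      then have "odd y" using evens'[of y] by auto
      then have "even (F - 1 - y)" using F F2 y' by auto
      then obtain j where "F - 1 - y = 2 * j" by (erule evenE)
      then have "y = F - 2 * j - 1" "j < k" using y' Fc by linarith+
      then show ?thesis by auto
    qed
  qed
  then have "card (insert 0 ?D) \<le> card ((H \<inter> {..<c}) \<union> (\<lambda>j. F - 2 * j - 1) ` {..<k})"
    by (intro card_mono) auto
  also have "\<dots> \<le> card (H \<inter> {..<c}) + card ((\<lambda>j. F - 2 * j - 1) ` {..<k})"
    by (rule card_Un_le)
  also have "card ((\<lambda>j. F - 2 * j - 1) ` {..<k}) \<le> k"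
    using card_image_le[of "{..<k}"] by simp
  finally have "card ?D + 1 \<le> card A + k" using cardA by simp
  also have "\<dots> \<le> card A + card C + 1" using cardC by simp
  also have "card A + card C = card (A \<union> C)"
    by (rule card_Un_disjoint[symmetric]) (use AC in \<open>auto simp: A_def C_def\<close>)
  also have "card (A \<union> C) \<le> card ?S" using AS CS by (intro card_mono) auto
  finally show ?thesis by simp
qed

theorem corollary3p7:
  fixes H :: "nat set" and g r :: nat
  assumes "numerical_semigroup H"
    and "genus H = g"
    and "g \<ge> 1"
    and "sparse H"
    and "r > 0"
    and "int (frobenius H) = 2 * int g - 2 * int r"
  shows "int g \<le> 4 * int r - 1"
proof -
  define F where "F = frobenius H"
  let ?D = "H \<inter> {1..<F}" and ?S = "{x \<in> {1..<F}. x \<notin> H \<and> Suc x \<notin> H}"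
  have fin: "finite (gaps H)" and H0: "0 \<in> H"
    using assms(1) by (auto simp: gaps_def numerical_semigroup_def)
  have ne: "gaps H \<noteq> {}" using assms(2,3) by (auto simp: genus_def)
  have Max: "F = Max (gaps H)"
    unfolding F_def using frobenius_eq_Max assms(1-3) by simp
  have F: "F \<notin> H" using Max_in[OF fin ne] Max by (simp add: gaps_def)
  then have F0: "F > 0" using H0 by (cases F) auto
  have iso: "F \<le> x" if "x \<in> H" "Suc x \<in> H" for x
    using sparse_isolated[of H x] assms that by (simp add: F_def)
  have one: "1 \<notin> H" using iso[of 0] H0 F0 by auto
  have "even (int F)" using assms(6) by (simp add: F_def)
  then have le: "card ?D \<le> card ?S"
    using card_nongaps_le_card_gap_pairs[OF assms(1) F _ iso] by simp
  have "gaps H \<union> ?D = {1..F}"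
  proof (intro equalityI subsetI)
    fix x assume "x \<in> gaps H \<union> ?D"
    then show "x \<in> {1..F}"
      using Max_ge[OF fin, of x] Max H0 by (cases x) (auto simp: gaps_def)
  qed (use F in \<open>auto simp: gaps_def nat_less_le\<close>)
  moreover have "card (gaps H \<union> ?D) = g + card ?D"
    using assms(2) fin by (subst card_Un_disjoint) (auto simp: gaps_def genus_def)
  ultimately have "g + card ?D = F" by simp
  \<comment> \<open>With \<open>card ?D = F - g\<close>, the bounds give
    \<open>3 * (F - g) \<le> F - 1\<close>; now substitute \<open>F = 2 * g - 2 * r\<close>.\<close>
  with le card_below_isolated[OF one F iso] F0 assms(6) show ?thesis
    unfolding F_def[symmetric] by linarith
qed

end
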